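(* Let $n\ge 4$ and $p\in[0,1]$. The Erdős–Rényi random graph $\mathbf G(n,p)$ is represented as a vertex-edge random graph $\mathbf G(n,\mathcal X,\mu,\phi)$ (i.e. the two induce the same probability measure on $\mathcal G_n$) if and only if $\phi(x,y)=p$ for $\mu$-almost every $x$ and $y$. In particular, if $n\ge4$ and $p\notin\{0,1\}$, then $\mathbf G(n,p)$ is not a vertex random graph.
   Context: For a positive integer $n$, let $\mathcal G_n$ be the set of simple graphs with vertex set $[n]$; a random graph is a probability measure on $\mathcal G_n$. The Erdős–Rényi random graph $\mathbf G(n,p)$ assigns $G\in\mathcal G_n$ probability $p^{|E(G)|}(1-p)^{\binom n2-|E(G)|}$. Given a probability space $(\mathcal X,\mu)$ and a symmetric measurable $\phi:\mathcal X\times\mathcal X\to[0,1]$, the vertex-edge random graph $\mathbf G(n,\mathcal X,\mu,\phi)$ is obtained by drawing $X_1,\dots,X_n$ i.i.d. from $\mu$ and then, conditionally independently for each pair $i<j$, including edge $ij$ with probability $\phi(X_i,X_j)$. A vertex random graph is a vertex-edge random graph in which $\phi$ takes values in $\{0,1\}$. *)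

theory Defs
  imports "HOL-Probability.Probability"
begin

text \<open>A simple graph with vertex set \<open>{1..n}\<close> is identified with its edge set.
  Random graphs are probability measures on the discrete space \<open>simple_graphs n\<close>.\<close>

definition simple_graphs :: "nat \<Rightarrow> nat set set set" where
  "simple_graphs n = Pow {e. e \<subseteq> {1..n} \<and> card e = 2}"

definition erdos_renyi :: "nat \<Rightarrow> real \<Rightarrow> nat set set measure" where
  "erdos_renyi n p = point_measure (simple_graphs n)
     (\<lambda>G. ennreal (p ^ card G * (1 - p) ^ ((n choose 2) - card G)))"

definition vertex_edge_data :: "'a measure \<Rightarrow> ('a \<times> 'a \<Rightarrow> real) \<Rightarrow> bool" where
  "vertex_edge_data M \<phi> \<longleftrightarrow>
     prob_space M \<and>
     \<phi> \<in> borel_measurable (M \<Otimes>\<^sub>M M) \<and>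
     (\<forall>x\<in>space M. \<forall>y\<in>space M. \<phi> (x, y) \<in> {0..1} \<and> \<phi> (x, y) = \<phi> (y, x))"

definition vertex_data :: "'a measure \<Rightarrow> ('a \<times> 'a \<Rightarrow> real) \<Rightarrow> bool" where
  "vertex_data M \<phi> \<longleftrightarrow>
     vertex_edge_data M \<phi> \<and> (\<forall>x\<in>space M. \<forall>y\<in>space M. \<phi> (x, y) \<in> {0, 1})"

definition index_pairs :: "nat \<Rightarrow> (nat \<times> nat) set" where
  "index_pairs n = {(i, j). 1 \<le> i \<and> i < j \<and> j \<le> n}"

text \<open>The conditional law of the graph given the vertex labels \<open>x 1, \<dots>, x n\<close>: an independent
  coin with success probability \<open>\<phi> (x i, x j)\<close> is tossed for every pair \<open>i < j\<close>.\<close>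

definition edge_sampling :: "nat \<Rightarrow> ('a \<times> 'a \<Rightarrow> real) \<Rightarrow> (nat \<Rightarrow> 'a) \<Rightarrow> nat set set measure" where
  "edge_sampling n \<phi> x =
     distr (measure_pmf (Pi_pmf (index_pairs n) False (\<lambda>(i, j). bernoulli_pmf (\<phi> (x i, x j)))))
       (count_space (simple_graphs n))
       (\<lambda>\<omega>. {{i, j} | i j. (i, j) \<in> index_pairs n \<and> \<omega> (i, j)})"

definition vertex_edge_random_graph ::
    "nat \<Rightarrow> 'a measure \<Rightarrow> ('a \<times> 'a \<Rightarrow> real) \<Rightarrow> nat set set measure" where
  "vertex_edge_random_graph n M \<phi> = (\<Pi>\<^sub>M i\<in>{1..n}. M) \<bind> edge_sampling n \<phi>"

end

(* Both laws are averages of products of independent coin tosses, so if they agree, then for every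
   edge set S the mean of the product of the weights over S is p^|S|. Expanding the product, the
   4-cycle 13, 14, 23, 24 has density zero in the kernel f = \<phi> - p. This density is the squared
   L2 norm of the codegree function h(y, z) = \<integral> f(x, y) f(x, z) dx, so h = 0 a.e., hence f
   integrates to zero over every measurable rectangle, hence f = 0 a.e. *)
theory Submission
  imports Defs
begin

section \<open>Graphs as sets of ordered index pairs\<close>

lemma finite_index_pairs [simp]: "finite (index_pairs n)"
  by (rule finite_subset[of _ "{1..n} \<times> {1..n}"]) (auto simp: index_pairs_def)

text \<open>The constraint \<open>i < j\<close> in \<open>index_pairs\<close> selects one ordered
  representative of each edge.\<close>

lemma inj_on_edge_index_pairs: "inj_on (\<lambda>(i, j). {i, j}) (index_pairs n)"
  by (auto simp: inj_on_def index_pairs_def doubleton_eq_iff)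

lemma edge_image_index_pairs:
  "(\<lambda>(i, j). {i, j}) ` index_pairs n = {e. e \<subseteq> {1..n} \<and> card e = 2}"
proof (intro equalityI subsetI)
  fix e assume e: "e \<in> {e. e \<subseteq> {1..n} \<and> card e = 2}"
  then obtain i j where ij: "e = {i, j}" "i \<noteq> j" by (auto simp: card_2_iff)
  have "(min i j, max i j) \<in> index_pairs n" "e = {min i j, max i j}"
    using e ij by (auto simp: index_pairs_def min_def max_def)
  then show "e \<in> (\<lambda>(i, j). {i, j}) ` index_pairs n" by force
qed (auto simp: index_pairs_def)

lemma simple_graphs_eq: "simple_graphs n = Pow ((\<lambda>(i, j). {i, j}) ` index_pairs n)"
  by (simp add: simple_graphs_def edge_image_index_pairs)

lemma finite_simple_graphs [simp]: "finite (simple_graphs n)"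
  by (simp add: simple_graphs_eq)

lemma card_index_pairs: "card (index_pairs n) = n choose 2"
  using card_image[OF inj_on_edge_index_pairs, of n] n_subsets[of "{1..n}" 2]
  by (simp add: edge_image_index_pairs)

section \<open>The conditional law of the graph given the labels\<close>

lemma sets_edge_sampling [simp]: "sets (edge_sampling n \<phi> x) = Pow (simple_graphs n)"
  and space_edge_sampling [simp]: "space (edge_sampling n \<phi> x) = simple_graphs n"
  by (simp_all add: edge_sampling_def)

lemma sampled_edges_measurable:
  "(\<lambda>\<omega>. {{i, j} | i j. (i, j) \<in> index_pairs n \<and> \<omega> (i, j)})
     \<in> measurable (measure_pmf P) (count_space (simple_graphs n))"
  by (auto simp: simple_graphs_eq)

lemma prob_space_edge_sampling: "prob_space (edge_sampling n \<phi> x)"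
  unfolding edge_sampling_def
  by (rule prob_space.prob_space_distr[OF measure_pmf.prob_space_axioms sampled_edges_measurable])

lemma edge_sampling_cong:
  assumes "\<And>i j. (i, j) \<in> index_pairs n \<Longrightarrow> \<phi> (x i, x j) = \<psi> (y i, y j)"
  shows "edge_sampling n \<phi> x = edge_sampling n \<psi> y"
proof -
  have "Pi_pmf (index_pairs n) False (\<lambda>(i, j). bernoulli_pmf (\<phi> (x i, x j))) =
        Pi_pmf (index_pairs n) False (\<lambda>(i, j). bernoulli_pmf (\<psi> (y i, y j)))"
    using assms by (intro Pi_pmf_cong) auto
  then show ?thesis by (simp add: edge_sampling_def)
qed

text \<open>Constraining each pair separately pulls back to a product set of coin outcomes, so
  independence of the coins gives a product. Choosing \<open>B\<close> yields both the law of a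
  single graph and the probability that prescribed edges are present.\<close>

lemma measure_edge_sampling_box:
  "measure (edge_sampling n \<phi> x)
      {G \<in> simple_graphs n. \<forall>(i, j)\<in>index_pairs n. ({i, j} \<in> G) \<in> B (i, j)} =
   (\<Prod>(i, j)\<in>index_pairs n. measure_pmf.prob (bernoulli_pmf (\<phi> (x i, x j))) (B (i, j)))"
proof -
  let ?f = "\<lambda>\<omega>. {{i, j} | i j. (i, j) \<in> index_pairs n \<and> \<omega> (i, j)}"
  let ?E = "{G \<in> simple_graphs n. \<forall>(i, j)\<in>index_pairs n. ({i, j} \<in> G) \<in> B (i, j)}"
  have mem: "{i, j} \<in> ?f \<omega> \<longleftrightarrow> \<omega> (i, j)" if "(i, j) \<in> index_pairs n" for i j and \<omega> :: "nat \<times> nat \<Rightarrow> bool"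
    using that by (auto simp: doubleton_eq_iff index_pairs_def)
  have "?f \<omega> \<in> simple_graphs n" for \<omega>
    by (auto simp: simple_graphs_eq)
  with mem have "?f -` ?E = Pi (index_pairs n) B"
    by (fastforce simp: Pi_def)
  then show ?thesis
    unfolding edge_sampling_def
    by (subst measure_distr[OF sampled_edges_measurable])
       (auto simp: measure_Pi_pmf_Pi split_def)
qed

text \<open>This is the box formula with a one-point set for every pair. The range hypothesis
  ensures that \<open>bernoulli_pmf\<close>, which truncates its parameter to the unit interval,
  uses the weight itself.\<close>

lemma measure_edge_sampling_singleton:
  assumes "G \<in> simple_graphs n"
    and \<phi>: "\<And>i j. (i, j) \<in> index_pairs n \<Longrightarrow> \<phi> (x i, x j) \<in> {0..1}"
  shows "measure (edge_sampling n \<phi> x) {G} =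
    (\<Prod>(i, j)\<in>index_pairs n. if {i, j} \<in> G then \<phi> (x i, x j) else 1 - \<phi> (x i, x j))"
proof -
  \<comment> \<open>A graph contains only edges that come from index pairs, so its membership
    pattern on these pairs determines it.\<close>
  have "H = G" if H: "H \<in> simple_graphs n"
    and eq: "\<forall>(i, j)\<in>index_pairs n. ({i, j} \<in> H) = ({i, j} \<in> G)" for H
  proof (rule set_eqI)
    fix e
    show "e \<in> H \<longleftrightarrow> e \<in> G"
    proof (cases "e \<in> (\<lambda>(i, j). {i, j}) ` index_pairs n")
      case True
      with eq show ?thesis by auto
    next
      case False
      with H assms(1) show ?thesis unfolding simple_graphs_eq by blast
    qed
  qed
  then have "{H \<in> simple_graphs n. \<forall>(i, j)\<in>index_pairs n. ({i, j} \<in> H) \<in> {{i, j} \<in> G}} = {G}"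
    using assms(1) unfolding singleton_iff by (intro equalityI subsetI) auto
  then have "measure (edge_sampling n \<phi> x) {G} = (\<Prod>(i, j)\<in>index_pairs n.
      measure_pmf.prob (bernoulli_pmf (\<phi> (x i, x j))) {{i, j} \<in> G})"
    using measure_edge_sampling_box[of n \<phi> x "\<lambda>(i, j). {{i, j} \<in> G}"] by simp
  also have "\<dots> = (\<Prod>(i, j)\<in>index_pairs n. if {i, j} \<in> G then \<phi> (x i, x j) else 1 - \<phi> (x i, x j))"
  proof (rule prod.cong[OF refl], clarify)
    fix i j assume "(i, j) \<in> index_pairs n"
    with \<phi>[of i j] show "measure_pmf.prob (bernoulli_pmf (\<phi> (x i, x j))) {{i, j} \<in> G} =
        (if {i, j} \<in> G then \<phi> (x i, x j) else 1 - \<phi> (x i, x j))"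
      by (simp add: measure_pmf_single)
  qed
  finally show ?thesis .
qed

text \<open>Requiring the edges of \<open>S\<close> leaves the other coins free: they contribute the
  factor 1, and no complementary weights \<open>1 - \<phi>\<close> appear.\<close>

lemma measure_edge_sampling_superset:
  assumes S: "S \<subseteq> index_pairs n"
    and \<phi>: "\<And>i j. (i, j) \<in> index_pairs n \<Longrightarrow> \<phi> (x i, x j) \<in> {0..1}"
  shows "measure (edge_sampling n \<phi> x) {G \<in> simple_graphs n. (\<lambda>(i, j). {i, j}) ` S \<subseteq> G} =
    (\<Prod>(i, j)\<in>S. \<phi> (x i, x j))"
proof -
  let ?B = "\<lambda>e. if e \<in> S then {True} else UNIV"
  have "{G \<in> simple_graphs n. (\<lambda>(i, j). {i, j}) ` S \<subseteq> G} =
    {G \<in> simple_graphs n. \<forall>(i, j)\<in>index_pairs n. ({i, j} \<in> G) \<in> ?B (i, j)}"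
    using S by fastforce
  then have "measure (edge_sampling n \<phi> x) {G \<in> simple_graphs n. (\<lambda>(i, j). {i, j}) ` S \<subseteq> G} =
    (\<Prod>(i, j)\<in>index_pairs n. measure_pmf.prob (bernoulli_pmf (\<phi> (x i, x j))) (?B (i, j)))"
    using measure_edge_sampling_box[of n \<phi> x ?B] by simp
  also have "\<dots> = (\<Prod>e\<in>index_pairs n. if e \<in> S then (case e of (i, j) \<Rightarrow> \<phi> (x i, x j)) else 1)"
    using \<phi> by (intro prod.cong) (auto simp: measure_pmf_single)
  also have "\<dots> = (\<Prod>(i, j)\<in>S. \<phi> (x i, x j))"
    using S by (simp add: prod.inter_restrict[symmetric] Int_absorb1)
  finally show ?thesis .
qed

text \<open>A constant kernel ignores the labels, so \<open>x\<close> is arbitrary. With this form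
  the formulas for \<open>edge_sampling\<close> apply to both random graphs.\<close>

lemma erdos_renyi_eq_edge_sampling:
  assumes "p \<in> {0..1}"
  shows "erdos_renyi n p = edge_sampling n (\<lambda>_. p) x"
proof (rule measure_eqI_finite)
  show "sets (erdos_renyi n p) = Pow (simple_graphs n)"
    by (simp add: erdos_renyi_def sets_point_measure)
  fix G assume G: "G \<in> simple_graphs n"
  interpret E: prob_space "edge_sampling n (\<lambda>_. p) x" by (rule prob_space_edge_sampling)
  \<comment> \<open>\<open>A\<close> encodes \<open>G\<close> by index pairs; injectivity of the
    encoding turns \<open>card A\<close> into the number of edges in the exponent.\<close>
  define A where "A = {e \<in> index_pairs n. (case e of (i, j) \<Rightarrow> {i, j}) \<in> G}"
  have A: "A \<subseteq> index_pairs n" "finite A" by (auto simp: A_def)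
  have "(\<lambda>(i, j). {i, j}) ` A = G"
    using G unfolding A_def simple_graphs_eq by blast
  then have card: "card A = card G"
    using card_image[OF inj_on_subset[OF inj_on_edge_index_pairs A(1)]] by simp
  have "measure (edge_sampling n (\<lambda>_. p) x) {G} = (\<Prod>e\<in>index_pairs n. if e \<in> A then p else 1 - p)"
    using assms G by (subst measure_edge_sampling_singleton) (auto simp: A_def intro!: prod.cong)
  also have "\<dots> = p ^ card A * (1 - p) ^ card (index_pairs n - A)"
    using A by (simp add: prod.If_cases Int_absorb1 Diff_eq[symmetric])
  also have "\<dots> = p ^ card G * (1 - p) ^ ((n choose 2) - card G)"
    using A by (simp add: card_Diff_subset card card_index_pairs)
  finally show "emeasure (erdos_renyi n p) {G} = emeasure (edge_sampling n (\<lambda>_. p) x) {G}"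
    using G by (simp add: erdos_renyi_def emeasure_point_measure_finite E.emeasure_eq_measure)
qed simp_all

section \<open>Averaging over the labels\<close>

context
  fixes M :: "'a measure" and \<phi> :: "'a \<times> 'a \<Rightarrow> real" and n :: nat
  assumes data: "vertex_edge_data M \<phi>"
begin

lemma vertex_edge_data_measurable: "\<phi> \<in> borel_measurable (M \<Otimes>\<^sub>M M)"
  using data by (simp add: vertex_edge_data_def)

lemma vertex_edge_data_range:
  assumes "x \<in> space (\<Pi>\<^sub>M i\<in>{1..n}. M)" "(i, j) \<in> index_pairs n"
  shows "\<phi> (x i, x j) \<in> {0..1}"
  using data assms by (force simp: vertex_edge_data_def space_PiM index_pairs_def PiE_def Pi_def)

lemma edge_weight_measurable:
  assumes "(i, j) \<in> index_pairs n"
  shows "(\<lambda>x. \<phi> (x i, x j)) \<in> borel_measurable (\<Pi>\<^sub>M i\<in>{1..n}. M)"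
proof -
  note [measurable] = vertex_edge_data_measurable
  have [measurable]: "i \<in> {1..n}" "j \<in> {1..n}" using assms by (auto simp: index_pairs_def)
  show ?thesis by measurable
qed

lemma prob_space_labels: "prob_space (\<Pi>\<^sub>M i\<in>{1..n}. M)"
  using data by (intro prob_space_PiM) (simp add: vertex_edge_data_def)

text \<open>This makes the conditional law a Markov kernel, as required for evaluating the bind.
  Since there are finitely many graphs, the probability of any event is a finite sum of products of
  the measurable functions \<open>\<phi> (x i, x j)\<close> and their complements.\<close>

lemma edge_sampling_measurable:
  "edge_sampling n \<phi> \<in> measurable (\<Pi>\<^sub>M i\<in>{1..n}. M) (subprob_algebra (count_space (simple_graphs n)))"
proof (rule measurable_subprob_algebra)
  fix A assume "A \<in> sets (count_space (simple_graphs n))"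
  then have A: "A \<subseteq> simple_graphs n" by simp
  then have fin: "finite A" by (rule finite_subset) simp
  have meas: "(\<lambda>x. \<Sum>G\<in>A. ennreal (\<Prod>e\<in>index_pairs n. if (case e of (i, j) \<Rightarrow> {i, j}) \<in> G
      then \<phi> (x (fst e), x (snd e)) else 1 - \<phi> (x (fst e), x (snd e))))
      \<in> borel_measurable (\<Pi>\<^sub>M i\<in>{1..n}. M)"
  proof (intro borel_measurable_sum measurable_compose[OF _ measurable_ennreal] borel_measurable_prod)
    fix G e assume "e \<in> index_pairs n"
    then have [measurable]: "(\<lambda>x. \<phi> (x (fst e), x (snd e))) \<in> borel_measurable (\<Pi>\<^sub>M i\<in>{1..n}. M)"
      by (intro edge_weight_measurable) simp
    show "(\<lambda>x. if (case e of (i, j) \<Rightarrow> {i, j}) \<in> G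
      then \<phi> (x (fst e), x (snd e)) else 1 - \<phi> (x (fst e), x (snd e)))
      \<in> borel_measurable (\<Pi>\<^sub>M i\<in>{1..n}. M)"
      by measurable
  qed
  have eq: "emeasure (edge_sampling n \<phi> x) A =
      (\<Sum>G\<in>A. ennreal (\<Prod>e\<in>index_pairs n. if (case e of (i, j) \<Rightarrow> {i, j}) \<in> G
      then \<phi> (x (fst e), x (snd e)) else 1 - \<phi> (x (fst e), x (snd e))))"
    if x: "x \<in> space (\<Pi>\<^sub>M i\<in>{1..n}. M)" for x
  proof -
    interpret E: prob_space "edge_sampling n \<phi> x" by (rule prob_space_edge_sampling)
    show ?thesis
      using A fin x vertex_edge_data_range
      by (subst emeasure_eq_sum_singleton)
         (auto simp: E.emeasure_eq_measure measure_edge_sampling_singleton split_def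
           subset_iff intro!: sum.cong)
  qed
  show "(\<lambda>x. emeasure (edge_sampling n \<phi> x) A) \<in> borel_measurable (\<Pi>\<^sub>M i\<in>{1..n}. M)"
    by (rule measurable_cong[THEN iffD2, OF eq meas])
qed (auto intro: prob_space_imp_subprob_space prob_space_edge_sampling)

lemma emeasure_vertex_edge_random_graph:
  assumes "A \<subseteq> simple_graphs n"
  shows "emeasure (vertex_edge_random_graph n M \<phi>) A =
    (\<integral>\<^sup>+x. emeasure (edge_sampling n \<phi> x) A \<partial>(\<Pi>\<^sub>M i\<in>{1..n}. M))"
  unfolding vertex_edge_random_graph_def
  using assms prob_space.not_empty[OF prob_space_labels]
  by (intro emeasure_bind[OF _ edge_sampling_measurable]) auto

lemma sets_vertex_edge_random_graph:
  "sets (vertex_edge_random_graph n M \<phi>) = Pow (simple_graphs n)"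
  unfolding vertex_edge_random_graph_def
  using prob_space.not_empty[OF prob_space_labels]
  by (subst sets_bind[where N = "count_space (simple_graphs n)"]) auto

text \<open>Both sides are the probability that all edges of \<open>S\<close> are present: on the
  right by independent coins of bias \<open>p\<close>, on the left by averaging the conditional
  probability over the labels. The forward direction draws on the equality of the two laws only
  through these moments.\<close>

lemma integral_prod_edge_weights:
  assumes S: "S \<subseteq> index_pairs n" and p: "p \<in> {0..1}"
    and eq: "erdos_renyi n p = vertex_edge_random_graph n M \<phi>"
  shows "(\<integral>x. (\<Prod>(i, j)\<in>S. \<phi> (x i, x j)) \<partial>(\<Pi>\<^sub>M i\<in>{1..n}. M)) = p ^ card S"
proof -
  let ?E = "{G \<in> simple_graphs n. (\<lambda>(i, j). {i, j}) ` S \<subseteq> G}"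
  let ?P = "\<Pi>\<^sub>M i\<in>{1..n}. M"
  interpret C: prob_space "edge_sampling n (\<lambda>_. p) x" for x :: "nat \<Rightarrow> nat"
    by (rule prob_space_edge_sampling)
  interpret E: prob_space "edge_sampling n \<phi> x" for x by (rule prob_space_edge_sampling)
  \<comment> \<open>The identity on the naturals serves as a dummy label vector for the constant
    kernel.\<close>
  have "ennreal (p ^ card S) = emeasure (erdos_renyi n p) ?E"
    using S p measure_edge_sampling_superset[OF S, of "\<lambda>_. p" "\<lambda>i. i"]
    by (simp add: erdos_renyi_eq_edge_sampling[where x = "\<lambda>i. i"] C.emeasure_eq_measure)
  also have "\<dots> = (\<integral>\<^sup>+x. ennreal (\<Prod>(i, j)\<in>S. \<phi> (x i, x j)) \<partial>?P)"
    unfolding eq E.emeasure_eq_measure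
      emeasure_vertex_edge_random_graph[of ?E, OF Collect_restrict]
    using S by (intro nn_integral_cong) (simp only: measure_edge_sampling_superset vertex_edge_data_range)
  finally have *: "(\<integral>\<^sup>+x. ennreal (\<Prod>(i, j)\<in>S. \<phi> (x i, x j)) \<partial>?P) = ennreal (p ^ card S)" ..
  have "(\<lambda>x. \<Prod>(i, j)\<in>S. \<phi> (x i, x j)) \<in> borel_measurable ?P"
    unfolding split_def
  proof (rule borel_measurable_prod)
    fix e assume "e \<in> S"
    then have "(fst e, snd e) \<in> index_pairs n" using S by auto
    then show "(\<lambda>x. \<phi> (x (fst e), x (snd e))) \<in> borel_measurable ?P"
      by (rule edge_weight_measurable)
  qed
  moreover have "0 \<le> (\<Prod>(i, j)\<in>S. \<phi> (x i, x j))" if "x \<in> space ?P" for x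
  proof (rule prod_nonneg)
    fix e assume "e \<in> S"
    then show "0 \<le> (case e of (i, j) \<Rightarrow> \<phi> (x i, x j))"
      using S vertex_edge_data_range[OF that, of "fst e" "snd e"] by (auto simp: split_def)
  qed
  ultimately have "(\<integral>x. (\<Prod>(i, j)\<in>S. \<phi> (x i, x j)) \<partial>?P) =
      enn2real (\<integral>\<^sup>+x. ennreal (\<Prod>(i, j)\<in>S. \<phi> (x i, x j)) \<partial>?P)"
    by (intro integral_eq_nn_integral AE_I2)
  also have "\<dots> = p ^ card S"
    unfolding * using p by simp
  finally show ?thesis .
qed

end

section \<open>Kernels with vanishing 4-cycle density\<close>

context prob_space
begin

text \<open>Because \<open>f\<close> is bounded by 1 in absolute value, \<open>1 + f\<close> is a
  nonnegative density. The measure it defines agrees with the product measure on rectangles, hence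
  everywhere, and uniqueness of densities forces \<open>1 + f = 1\<close> almost everywhere.\<close>

lemma AE_zero_if_rectangle_integrals_zero:
  fixes f :: "'a \<times> 'a \<Rightarrow> real"
  assumes [measurable]: "f \<in> borel_measurable (M \<Otimes>\<^sub>M M)"
    and bound: "\<And>z. z \<in> space (M \<Otimes>\<^sub>M M) \<Longrightarrow> \<bar>f z\<bar> \<le> 1"
    and rect: "\<And>A B. A \<in> sets M \<Longrightarrow> B \<in> sets M \<Longrightarrow>
      (\<integral>z. indicator (A \<times> B) z * f z \<partial>(M \<Otimes>\<^sub>M M)) = 0"
  shows "AE z in M \<Otimes>\<^sub>M M. f z = 0"
proof -
  interpret P: pair_prob_space M M ..
  let ?D = "density (M \<Otimes>\<^sub>M M) (\<lambda>z. ennreal (1 + f z))"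
  have "M \<Otimes>\<^sub>M M = ?D"
  proof (rule pair_measure_eqI)
    fix A B assume AB [measurable]: "A \<in> sets M" "B \<in> sets M"
    have int: "integrable (M \<Otimes>\<^sub>M M) (\<lambda>z. indicator (A \<times> B) z * f z)"
      by (rule P.integrable_const_bound[where B = 1])
         (use bound in \<open>auto simp: indicator_def\<close>)
    have int1: "integrable (M \<Otimes>\<^sub>M M) (indicator (A \<times> B) :: _ \<Rightarrow> real)"
      by (rule P.integrable_const_bound[where B = 1]) auto
    have "emeasure ?D (A \<times> B) = (\<integral>\<^sup>+z. ennreal (indicator (A \<times> B) z + indicator (A \<times> B) z * f z) \<partial>(M \<Otimes>\<^sub>M M))"
      by (subst emeasure_density) (auto intro!: nn_integral_cong simp: indicator_def)
    also have "\<dots> = ennreal (\<integral>z. indicator (A \<times> B) z + indicator (A \<times> B) z * f z \<partial>(M \<Otimes>\<^sub>M M))"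
    proof (intro nn_integral_eq_integral AE_I2)
      show "0 \<le> indicator (A \<times> B) z + indicator (A \<times> B) z * f z" if "z \<in> space (M \<Otimes>\<^sub>M M)" for z
        using bound[OF that] by (auto simp: indicator_def)
    qed (use int int1 in auto)
    also have "\<dots> = ennreal (measure (M \<Otimes>\<^sub>M M) (A \<times> B))"
      using rect[OF AB] int int1 by (subst Bochner_Integration.integral_add) auto
    also have "\<dots> = emeasure M A * emeasure M B"
      by (simp add: P.emeasure_eq_measure[symmetric] emeasure_pair_measure_Times)
    finally show "emeasure M A * emeasure M B = emeasure ?D (A \<times> B)" ..
  qed (simp_all add: sigma_finite_measure_axioms)
  then have "density (M \<Otimes>\<^sub>M M) (\<lambda>z. 1) = ?D"
    by (simp add: density_1)
  then have "AE z in M \<Otimes>\<^sub>M M. 1 = ennreal (1 + f z)"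
    by (subst (asm) P.density_unique_iff) auto
  then show ?thesis
  proof (rule AE_mp, intro AE_I2 impI)
    fix z assume "z \<in> space (M \<Otimes>\<^sub>M M)" "1 = ennreal (1 + f z)"
    then show "f z = 0"
      using ennreal_eq_1[of "1 + f z"] by simp
  qed
qed

text \<open>The cycle has sides \<open>x, x'\<close> and \<open>y, z\<close>. For fixed
  \<open>(y, z)\<close> the integral over \<open>(x, x')\<close> factors as the square of the
  codegree \<open>h (y, z)\<close>, so \<open>h\<close> vanishes almost everywhere. The integral of
  \<open>f\<close> over \<open>A \<times> B\<close> is then controlled by the row integrals over
  \<open>B\<close>, whose squares average to the integral of \<open>h\<close> over
  \<open>B \<times> B\<close>.\<close>

lemma AE_zero_if_C4_density_zero:
  fixes f :: "'a \<times> 'a \<Rightarrow> real"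
  assumes [measurable]: "f \<in> borel_measurable (M \<Otimes>\<^sub>M M)"
    and bound: "\<And>x y. x \<in> space M \<Longrightarrow> y \<in> space M \<Longrightarrow> \<bar>f (x, y)\<bar> \<le> 1"
    and C4: "(\<integral>((x, x'), (y, z)). f (x, y) * f (x, z) * f (x', y) * f (x', z)
               \<partial>((M \<Otimes>\<^sub>M M) \<Otimes>\<^sub>M (M \<Otimes>\<^sub>M M))) = 0"
  shows "AE z in M \<Otimes>\<^sub>M M. f z = 0"
proof -
  interpret P: pair_prob_space M M ..
  interpret Q: pair_prob_space "M \<Otimes>\<^sub>M M" "M \<Otimes>\<^sub>M M" ..
  interpret R: pair_prob_space M "M \<Otimes>\<^sub>M M" ..
  define h where "h = (\<lambda>w. \<integral>x. f (x, fst w) * f (x, snd w) \<partial>M)"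
  have bound': "\<bar>f (x, y) * f (x', z)\<bar> \<le> 1"
    if "x \<in> space M" "x' \<in> space M" "y \<in> space M" "z \<in> space M" for x x' y z
    using mult_mono[OF bound bound, of x y x' z] that by (simp add: abs_mult)
  have [measurable]: "h \<in> borel_measurable (M \<Otimes>\<^sub>M M)"
    unfolding h_def by measurable
  have h_le: "\<bar>h w\<bar> \<le> 1" if "w \<in> space (M \<Otimes>\<^sub>M M)" for w
  proof -
    have w: "fst w \<in> space M" "snd w \<in> space M" using that by (auto simp: space_pair_measure)
    have "\<bar>h w\<bar> \<le> (\<integral>x. 1 \<partial>M)"
      unfolding h_def
      using w bound'
      by (intro order_trans[OF integral_abs_bound] integral_mono_AE') (auto intro!: AE_I2 integrable_const)
    then show ?thesis by (simp add: prob_space)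
  qed
  \<comment> \<open>The square of an integral is a double integral over two independent copies
    \<open>x\<close>, \<open>x'\<close> of the integration variable.\<close>
  have "(\<integral>w. (h w)\<^sup>2 \<partial>(M \<Otimes>\<^sub>M M)) =
      (\<integral>w. (\<integral>v. f (fst v, fst w) * f (fst v, snd w) * f (snd v, fst w) * f (snd v, snd w)
        \<partial>(M \<Otimes>\<^sub>M M)) \<partial>(M \<Otimes>\<^sub>M M))"
  proof (rule Bochner_Integration.integral_cong[OF refl])
    fix w assume "w \<in> space (M \<Otimes>\<^sub>M M)"
    then have w [measurable]: "fst w \<in> space M" "snd w \<in> space M" by (auto simp: space_pair_measure)
    have int: "integrable (M \<Otimes>\<^sub>M M)
      (\<lambda>(x, x'). (f (x, fst w) * f (x, snd w)) * (f (x', fst w) * f (x', snd w)))"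
    proof (rule P.integrable_const_bound[where B = 1], rule AE_I2)
      fix v assume "v \<in> space (M \<Otimes>\<^sub>M M)"
      then show "norm (case v of (x, x') \<Rightarrow> (f (x, fst w) * f (x, snd w)) * (f (x', fst w) * f (x', snd w))) \<le> 1"
        using w mult_mono[OF bound' bound', of "fst v" "fst v" "fst w" "snd w" "snd v" "snd v" "fst w" "snd w"]
        by (auto simp: space_pair_measure abs_mult)
    qed measurable
    have "(h w)\<^sup>2 = (\<integral>x. \<integral>x'. (f (x, fst w) * f (x, snd w)) * (f (x', fst w) * f (x', snd w)) \<partial>M \<partial>M)"
      by (simp add: h_def power2_eq_square)
    also have "\<dots> = (\<integral>v. (case v of (x, x') \<Rightarrow> (f (x, fst w) * f (x, snd w)) * (f (x', fst w) * f (x', snd w))) \<partial>(M \<Otimes>\<^sub>M M))"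
      by (rule P.integral_fst[OF int])
    finally show "(h w)\<^sup>2 = (\<integral>v. f (fst v, fst w) * f (fst v, snd w) * f (snd v, fst w) * f (snd v, snd w)
        \<partial>(M \<Otimes>\<^sub>M M))"
      by (simp add: split_def mult_ac)
  qed
  also have "\<dots> = (\<integral>(v, w). f (fst v, fst w) * f (fst v, snd w) * f (snd v, fst w) * f (snd v, snd w)
      \<partial>((M \<Otimes>\<^sub>M M) \<Otimes>\<^sub>M (M \<Otimes>\<^sub>M M)))"
  proof (rule Q.integral_snd, rule Q.integrable_const_bound[where B = 1], rule AE_I2)
    fix u assume "u \<in> space ((M \<Otimes>\<^sub>M M) \<Otimes>\<^sub>M (M \<Otimes>\<^sub>M M))"
    then obtain x x' y z where u: "u = ((x, x'), (y, z))"
      "x \<in> space M" "x' \<in> space M" "y \<in> space M" "z \<in> space M"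
      by (auto simp: space_pair_measure)
    show "norm (case u of (v, w) \<Rightarrow>
        f (fst v, fst w) * f (fst v, snd w) * f (snd v, fst w) * f (snd v, snd w)) \<le> 1"
      using u mult_mono[OF bound' bound', of x x y z x' x' y z] by (simp add: abs_mult mult_ac)
  qed measurable
  also have "\<dots> = 0" using C4 by (simp add: split_def)
  finally have "(\<integral>w. (h w)\<^sup>2 \<partial>(M \<Otimes>\<^sub>M M)) = 0" .
  then have "AE w in M \<Otimes>\<^sub>M M. (h w)\<^sup>2 = 0"
    by (subst (asm) integral_nonneg_eq_0_iff_AE)
       (auto intro!: P.integrable_const_bound[where B = 1] AE_I2 simp: h_le abs_square_le_1)
  then have h0: "AE w in M \<Otimes>\<^sub>M M. h w = 0" by simp
  show ?thesis
  proof (rule AE_zero_if_rectangle_integrals_zero)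
    fix A B assume [measurable]: "A \<in> sets M" "B \<in> sets M"
    \<comment> \<open>\<open>k x\<close> is the signed degree of \<open>x\<close> into
      \<open>B\<close>. Its square is an integral over pairs \<open>(y, z)\<close> in
      \<open>B \<times> B\<close>; integrating over \<open>x\<close> first then brings out
      \<open>h (y, z)\<close>.\<close>
    define k where "k = (\<lambda>x. \<integral>y. indicator B y * f (x, y) \<partial>M)"
    have [measurable]: "k \<in> borel_measurable M" unfolding k_def by measurable
    have k_sq: "(k x)\<^sup>2 = (\<integral>w. indicator B (fst w) * indicator B (snd w) * (f (x, fst w) * f (x, snd w)) \<partial>(M \<Otimes>\<^sub>M M))"
      if x [measurable]: "x \<in> space M" for x
    proof -
      have int: "integrable (M \<Otimes>\<^sub>M M) (\<lambda>(y, z). (indicator B y * f (x, y)) * (indicator B z * f (x, z)))"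
        by (rule P.integrable_const_bound[where B = 1])
           (use bound' x in \<open>auto intro!: AE_I2 simp: space_pair_measure indicator_def\<close>)
      have "(k x)\<^sup>2 = (\<integral>y. \<integral>z. (indicator B y * f (x, y)) * (indicator B z * f (x, z)) \<partial>M \<partial>M)"
        by (simp add: k_def power2_eq_square)
      also have "\<dots> = (\<integral>w. (case w of (y, z) \<Rightarrow> (indicator B y * f (x, y)) * (indicator B z * f (x, z))) \<partial>(M \<Otimes>\<^sub>M M))"
        by (rule P.integral_fst[OF int])
      finally show ?thesis by (simp add: split_def mult_ac)
    qed
    have "(\<integral>x. (k x)\<^sup>2 \<partial>M) = (\<integral>x. \<integral>w. indicator B (fst w) * indicator B (snd w) * (f (x, fst w) * f (x, snd w)) \<partial>(M \<Otimes>\<^sub>M M) \<partial>M)"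
      by (intro Bochner_Integration.integral_cong refl k_sq)
    also have "\<dots> = (\<integral>w. \<integral>x. indicator B (fst w) * indicator B (snd w) * (f (x, fst w) * f (x, snd w)) \<partial>M \<partial>(M \<Otimes>\<^sub>M M))"
    proof (rule R.Fubini_integral[symmetric], rule R.integrable_const_bound[where B = 1])
      show "AE u in M \<Otimes>\<^sub>M (M \<Otimes>\<^sub>M M). norm (case u of (x, w) \<Rightarrow>
          indicator B (fst w) * indicator B (snd w) * (f (x, fst w) * f (x, snd w))) \<le> 1"
        using bound' by (auto intro!: AE_I2 simp: space_pair_measure indicator_def)
    qed measurable
    also have "\<dots> = (\<integral>w. indicator B (fst w) * indicator B (snd w) * h w \<partial>(M \<Otimes>\<^sub>M M))"
      by (simp add: h_def)
    also have "\<dots> = 0"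
      by (rule integral_eq_zero_AE) (use h0 in auto)
    finally have "(\<integral>x. (k x)\<^sup>2 \<partial>M) = 0" .
    moreover have "\<bar>k x\<bar> \<le> 1" if "x \<in> space M" for x
    proof -
      have "\<bar>k x\<bar> \<le> (\<integral>x. 1 \<partial>M)"
        unfolding k_def
        using that bound
        by (intro order_trans[OF integral_abs_bound] integral_mono_AE')
           (auto intro!: AE_I2 integrable_const simp: indicator_def)
      then show ?thesis by (simp add: prob_space)
    qed
    ultimately have "AE x in M. (k x)\<^sup>2 = 0"
      by (subst (asm) integral_nonneg_eq_0_iff_AE)
         (auto intro!: integrable_const_bound[where B = 1] AE_I2 simp: abs_square_le_1)
    then have k0: "AE x in M. k x = 0" by simp
    \<comment> \<open>Integrating over \<open>y\<close> first reduces the rectangle to the integral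
      of \<open>k\<close> over \<open>A\<close>.\<close>
    have "(\<integral>z. indicator (A \<times> B) z * f z \<partial>(M \<Otimes>\<^sub>M M)) =
        (\<integral>(x, y). indicator A x * (indicator B y * f (x, y)) \<partial>(M \<Otimes>\<^sub>M M))"
      by (simp add: split_def indicator_times mult_ac)
    also have "\<dots> = (\<integral>x. \<integral>y. indicator A x * (indicator B y * f (x, y)) \<partial>M \<partial>M)"
      by (rule P.integral_fst[symmetric], rule P.integrable_const_bound[where B = 1])
         (use bound in \<open>auto intro!: AE_I2 simp: space_pair_measure indicator_def\<close>)
    also have "\<dots> = (\<integral>x. indicator A x * k x \<partial>M)"
      by (simp add: k_def)
    also have "\<dots> = 0"
      by (rule integral_eq_zero_AE) (use k0 in auto)
    finally show "(\<integral>z. indicator (A \<times> B) z * f z \<partial>(M \<Otimes>\<^sub>M M)) = 0" .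
  qed (use bound in \<open>auto simp: space_pair_measure\<close>)
qed

section \<open>Joint laws of distinct labels\<close>

lemma indep_vars_PiM_components:
  assumes "finite I" "I \<noteq> {}"
  shows "prob_space.indep_vars (\<Pi>\<^sub>M i\<in>I. M) (\<lambda>_. M) (\<lambda>i x. x i) I"
proof -
  interpret L: prob_space "\<Pi>\<^sub>M i\<in>I. M" by (intro prob_space_PiM prob_space_axioms)
  \<comment> \<open>Points of the product space are extensional functions, so restricting them to
    \<open>I\<close> changes nothing: the joint law of the coordinates is the product measure
    itself.\<close>
  have "distr (\<Pi>\<^sub>M i\<in>I. M) (\<Pi>\<^sub>M i\<in>I. M) (\<lambda>x. \<lambda>i\<in>I. x i) = distr (\<Pi>\<^sub>M i\<in>I. M) (\<Pi>\<^sub>M i\<in>I. M) (\<lambda>x. x)"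
    by (rule distr_cong) (auto simp: space_PiM)
  also have "\<dots> = (\<Pi>\<^sub>M i\<in>I. distr (\<Pi>\<^sub>M i\<in>I. M) M (\<lambda>x. x i))"
    by (simp, rule PiM_cong) (auto simp: distr_PiM_component[of I "\<lambda>_. M"] prob_space_axioms)
  finally show ?thesis
    by (subst L.indep_vars_iff_distr_eq_PiM') (use assms in auto)
qed

lemma distr_PiM_pair:
  assumes "finite I" "i \<in> I" "j \<in> I" "i \<noteq> j"
  shows "distr (\<Pi>\<^sub>M i\<in>I. M) (M \<Otimes>\<^sub>M M) (\<lambda>x. (x i, x j)) = M \<Otimes>\<^sub>M M"
proof -
  interpret L: prob_space "\<Pi>\<^sub>M i\<in>I. M" by (intro prob_space_PiM prob_space_axioms)
  have "L.indep_var (PiM {i} (\<lambda>_. M)) (\<lambda>x. \<lambda>i\<in>{i}. x i) (PiM {j} (\<lambda>_. M)) (\<lambda>x. \<lambda>i\<in>{j}. x i)"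
    by (rule L.indep_var_restrict[OF indep_vars_PiM_components]) (use assms in auto)
  then have "L.indep_var M ((\<lambda>x. x i) \<circ> (\<lambda>x. \<lambda>i\<in>{i}. x i)) M ((\<lambda>x. x j) \<circ> (\<lambda>x. \<lambda>i\<in>{j}. x i))"
    by (rule L.indep_var_compose) simp_all
  then show ?thesis
    using assms by (simp add: L.indep_var_distribution_eq comp_def distr_PiM_component[of I "\<lambda>_. M"] prob_space_axioms)
qed

text \<open>The disjoint blocks \<open>{a, b}\<close> and \<open>{c, d}\<close> of labels are
  independent, and each block has law \<open>M \<Otimes>\<^sub>M M\<close>. The nesting matches the
  two sides of the 4-cycle.\<close>

lemma distr_PiM_quadruple:
  assumes "finite I" "{a, b, c, d} \<subseteq> I" "distinct [a, b, c, d]"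
  shows "distr (\<Pi>\<^sub>M i\<in>I. M) ((M \<Otimes>\<^sub>M M) \<Otimes>\<^sub>M (M \<Otimes>\<^sub>M M)) (\<lambda>x. ((x a, x b), (x c, x d))) =
    (M \<Otimes>\<^sub>M M) \<Otimes>\<^sub>M (M \<Otimes>\<^sub>M M)"
proof -
  interpret L: prob_space "\<Pi>\<^sub>M i\<in>I. M" by (intro prob_space_PiM prob_space_axioms)
  have "L.indep_var (PiM {a, b} (\<lambda>_. M)) (\<lambda>x. \<lambda>i\<in>{a, b}. x i) (PiM {c, d} (\<lambda>_. M)) (\<lambda>x. \<lambda>i\<in>{c, d}. x i)"
    by (rule L.indep_var_restrict[OF indep_vars_PiM_components]) (use assms in auto)
  then have "L.indep_var (M \<Otimes>\<^sub>M M) ((\<lambda>x. (x a, x b)) \<circ> (\<lambda>x. \<lambda>i\<in>{a, b}. x i))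
      (M \<Otimes>\<^sub>M M) ((\<lambda>x. (x c, x d)) \<circ> (\<lambda>x. \<lambda>i\<in>{c, d}. x i))"
    by (rule L.indep_var_compose) measurable
  then show ?thesis
    using assms by (simp add: L.indep_var_distribution_eq comp_def distr_PiM_pair)
qed

end

section \<open>The two directions of the equivalence\<close>

lemma erdos_renyi_eqI_AE:
  fixes M :: "'a measure"
  assumes data: "vertex_edge_data M \<phi>" and p: "p \<in> {0..1}" and AE: "AE z in M \<Otimes>\<^sub>M M. \<phi> z = p"
  shows "erdos_renyi n p = vertex_edge_random_graph n M \<phi>"
proof (rule measure_eqI)
  let ?P = "\<Pi>\<^sub>M i\<in>{1..n}. M"
  interpret prob_space M using data unfolding vertex_edge_data_def by blast
  interpret L: prob_space ?P by (rule prob_space_labels[OF data])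
  show "sets (erdos_renyi n p) = sets (vertex_edge_random_graph n M \<phi>)"
    by (simp add: sets_vertex_edge_random_graph[OF data] erdos_renyi_def sets_point_measure)
  fix A assume "A \<in> sets (erdos_renyi n p)"
  then have A: "A \<subseteq> simple_graphs n" by (simp add: erdos_renyi_def sets_point_measure)
  \<comment> \<open>Two distinct labels have joint law \<open>M \<Otimes>\<^sub>M M\<close>, so the
    exceptional null set pulls back to a null set of label vectors. There are finitely many pairs,
    so one null set serves for all of them.\<close>
  have "AE x in ?P. \<phi> (x (fst e), x (snd e)) = p" if "e \<in> index_pairs n" for e
  proof -
    have e: "fst e \<in> {1..n}" "snd e \<in> {1..n}" "fst e \<noteq> snd e"
      using that by (auto simp: index_pairs_def)
    have "(\<lambda>x. (x (fst e), x (snd e))) \<in> measurable ?P (M \<Otimes>\<^sub>M M)"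
      using e by measurable
    moreover have "AE z in distr ?P (M \<Otimes>\<^sub>M M) (\<lambda>x. (x (fst e), x (snd e))). \<phi> z = p"
      unfolding distr_PiM_pair[OF finite_atLeastAtMost e] by (rule AE)
    ultimately show ?thesis by (rule AE_distrD)
  qed
  then have "AE x in ?P. \<forall>e\<in>index_pairs n. \<phi> (x (fst e), x (snd e)) = p"
    by (intro AE_finite_allI) auto
  then have "AE x in ?P. edge_sampling n \<phi> x = edge_sampling n (\<lambda>_. p) x"
    by (rule AE_mp) (auto intro!: AE_I2 edge_sampling_cong)
  then have "AE x in ?P. emeasure (edge_sampling n \<phi> x) A = emeasure (erdos_renyi n p) A"
    by (rule AE_mp) (auto intro!: AE_I2 simp: erdos_renyi_eq_edge_sampling[OF p, symmetric])
  then have "(\<integral>\<^sup>+x. emeasure (edge_sampling n \<phi> x) A \<partial>?P) = (\<integral>\<^sup>+x. emeasure (erdos_renyi n p) A \<partial>?P)"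
    by (rule nn_integral_cong_AE)
  then show "emeasure (erdos_renyi n p) A = emeasure (vertex_edge_random_graph n M \<phi>) A"
    by (simp add: emeasure_vertex_edge_random_graph[OF data A] L.emeasure_space_1 del: One_nat_def)
qed

text \<open>Four labels are available, so the 4-cycle fits into the graph. Expanding the product of
  \<open>\<phi> - p\<close> over its edges leaves only moments that agree with those of the constant
  kernel \<open>p\<close>, for which the product is zero.\<close>

lemma AE_eq_if_erdos_renyi_eq:
  fixes M :: "'a measure"
  assumes data: "vertex_edge_data M \<phi>" and p: "p \<in> {0..1}" and n: "n \<ge> 4"
    and eq: "erdos_renyi n p = vertex_edge_random_graph n M \<phi>"
  shows "AE z in M \<Otimes>\<^sub>M M. \<phi> z = p"
proof -
  let ?P = "\<Pi>\<^sub>M i\<in>{1..n}. M"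
  interpret prob_space M using data unfolding vertex_edge_data_def by blast
  interpret L: prob_space ?P by (rule prob_space_labels[OF data])
  note [measurable] = vertex_edge_data_measurable[OF data]
  define f where "f = (\<lambda>z. \<phi> z - p)"
  \<comment> \<open>The 4-cycle with sides 1, 2 and 3, 4. Every edge runs from the first side to the
    second, so its indices are already in increasing order.\<close>
  define Q :: "(nat \<times> nat) set" where "Q = {(1, 3), (1, 4), (2, 3), (2, 4)}"
  have Q: "Q \<subseteq> index_pairs n" "finite Q" using n by (auto simp: Q_def index_pairs_def)
  have [measurable]: "f \<in> borel_measurable (M \<Otimes>\<^sub>M M)" unfolding f_def by measurable
  have weights_meas: "(\<lambda>x. \<Prod>(i, j)\<in>S. \<phi> (x i, x j)) \<in> borel_measurable ?P" if "S \<subseteq> Q" for S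
    unfolding split_def
    using that Q(1) by (intro borel_measurable_prod edge_weight_measurable[OF data]) auto
  have weights_bound: "norm (\<Prod>(i, j)\<in>S. \<phi> (x i, x j)) \<le> 1" if "S \<subseteq> Q" "x \<in> space ?P" for S x
  proof -
    have "\<bar>case e of (i, j) \<Rightarrow> \<phi> (x i, x j)\<bar> \<le> 1" if "e \<in> S" for e
      using vertex_edge_data_range[OF data \<open>x \<in> space ?P\<close>, of "fst e" "snd e"] that \<open>S \<subseteq> Q\<close> Q(1)
      by (auto simp: split_def)
    then show ?thesis
      unfolding real_norm_def abs_prod by (intro prod_le_1) auto
  qed
  have int: "integrable ?P (\<lambda>x. (\<Prod>(i, j)\<in>S. \<phi> (x i, x j)) * c)" if "S \<subseteq> Q" for S and c :: real
    by (intro integrable_mult_left L.integrable_const_bound[where B = 1] AE_I2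
        weights_meas weights_bound that)
  have "(\<integral>x. (\<Prod>(i, j)\<in>Q. f (x i, x j)) \<partial>?P) =
      (\<integral>x. (\<Sum>S\<in>Pow Q. (\<Prod>(i, j)\<in>S. \<phi> (x i, x j)) * (\<Prod>e\<in>Q - S. - p)) \<partial>?P)"
    using prod_add[OF Q(2), of "\<lambda>(i, j). \<phi> (x i, x j)" "\<lambda>_. - p" for x]
    by (intro Bochner_Integration.integral_cong refl) (simp add: f_def split_def)
  also have "\<dots> = (\<Sum>S\<in>Pow Q. (\<integral>x. (\<Prod>(i, j)\<in>S. \<phi> (x i, x j)) * (\<Prod>e\<in>Q - S. - p) \<partial>?P))"
    by (rule Bochner_Integration.integral_sum) (use int in blast)
  also have "\<dots> = (\<Sum>S\<in>Pow Q. (\<Prod>e\<in>S. p) * (\<Prod>e\<in>Q - S. - p))"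
  proof (rule sum.cong[OF refl])
    fix S assume "S \<in> Pow Q"
    then have "S \<subseteq> index_pairs n" using Q(1) by auto
    from integral_prod_edge_weights[OF data this p eq]
    show "(\<integral>x. (\<Prod>(i, j)\<in>S. \<phi> (x i, x j)) * (\<Prod>e\<in>Q - S. - p) \<partial>?P) =
        (\<Prod>e\<in>S. p) * (\<Prod>e\<in>Q - S. - p)"
      by simp
  qed
  \<comment> \<open>The same expansion read backwards, now with \<open>p\<close> in place of every
    edge weight.\<close>
  also have "\<dots> = (\<Prod>e\<in>Q. p + - p)"
    by (rule prod_add[OF Q(2), symmetric])
  also have "\<dots> = 0" by (simp add: Q_def)
  finally have zero: "(\<integral>x. (\<Prod>(i, j)\<in>Q. f (x i, x j)) \<partial>?P) = 0" .
  let ?F = "\<lambda>((x, x'), (y, z)). f (x, y) * f (x, z) * f (x', y) * f (x', z)"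
  \<comment> \<open>\<open>?T\<close> sends labels 1, 2 to \<open>x, x'\<close> and labels 3, 4 to
    \<open>y, z\<close>, which turns the product over \<open>Q\<close> into the integrand
    \<open>?F\<close>.\<close>
  let ?T = "\<lambda>x :: nat \<Rightarrow> 'a. ((x 1, x 2), (x 3, x 4))"
  have idx [measurable]: "1 \<in> {1..n}" "2 \<in> {1..n}" "3 \<in> {1..n}" "4 \<in> {1..n}" using n by auto
  have "distr ?P ((M \<Otimes>\<^sub>M M) \<Otimes>\<^sub>M (M \<Otimes>\<^sub>M M)) ?T = (M \<Otimes>\<^sub>M M) \<Otimes>\<^sub>M (M \<Otimes>\<^sub>M M)"
    using idx by (intro distr_PiM_quadruple) auto
  then have "integral\<^sup>L ((M \<Otimes>\<^sub>M M) \<Otimes>\<^sub>M (M \<Otimes>\<^sub>M M)) ?F =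
      integral\<^sup>L (distr ?P ((M \<Otimes>\<^sub>M M) \<Otimes>\<^sub>M (M \<Otimes>\<^sub>M M)) ?T) ?F"
    by simp
  also have "\<dots> = (\<integral>x. ?F (?T x) \<partial>?P)"
    by (rule integral_distr) (unfold split_def, measurable)
  also have "\<dots> = 0"
    using zero by (simp add: Q_def mult_ac)
  finally have "AE z in M \<Otimes>\<^sub>M M. f z = 0"
  \<comment> \<open>The rotation puts the 4-cycle premise first, where the chained equation
    discharges it.\<close>
  proof (rule AE_zero_if_C4_density_zero[rotated 2])
    fix x y assume "x \<in> space M" "y \<in> space M"
    then have "\<phi> (x, y) \<in> {0..1}" using data unfolding vertex_edge_data_def by blast
    with p show "\<bar>f (x, y)\<bar> \<le> 1" by (auto simp: f_def)
  qed measurable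
  then show ?thesis by (simp add: f_def)
qed

section \<open>Vertex random graphs and the conclusion\<close>

lemma vertex_data_imp_p_0_or_1:
  fixes M :: "'a measure"
  assumes data: "vertex_data M \<phi>" and AE: "AE z in M \<Otimes>\<^sub>M M. \<phi> z = p"
  shows "p \<in> {0, 1}"
proof -
  interpret prob_space M using data unfolding vertex_data_def vertex_edge_data_def by blast
  interpret P: pair_prob_space M M ..
  \<comment> \<open>Almost everywhere \<open>p\<close> is a value of \<open>\<phi>\<close>, hence 0
    or 1. This statement does not depend on \<open>z\<close>, so on a probability space it holds
    outright.\<close>
  have "AE z in M \<Otimes>\<^sub>M M. p \<in> {0, 1}"
    using AE AE_space
  proof eventually_elim
    case (elim z)
    then have "\<phi> (fst z, snd z) \<in> {0, 1}"
      using data unfolding vertex_data_def space_pair_measure by (metis mem_Times_iff)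
    with elim show ?case by simp
  qed
  then show ?thesis by (simp add: P.AE_const)
qed

theorem theorem4p2:
  fixes n :: nat and p :: real and M :: "'a measure" and \<phi> :: "'a \<times> 'a \<Rightarrow> real"
  assumes "n \<ge> 4" and "p \<in> {0..1}"
  shows "(vertex_edge_data M \<phi> \<longrightarrow>
            (erdos_renyi n p = vertex_edge_random_graph n M \<phi> \<longleftrightarrow>
              (AE z in M \<Otimes>\<^sub>M M. \<phi> z = p)))
         \<and> (p \<notin> {0, 1} \<longrightarrow>
            \<not> (\<exists>(N :: 'b measure) \<psi>. vertex_data N \<psi> \<and>
                 erdos_renyi n p = vertex_edge_random_graph n N \<psi>))"
proof (intro conjI impI)
  assume "vertex_edge_data M \<phi>"
  then show "erdos_renyi n p = vertex_edge_random_graph n M \<phi> \<longleftrightarrow> (AE z in M \<Otimes>\<^sub>M M. \<phi> z = p)"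
    using assms AE_eq_if_erdos_renyi_eq erdos_renyi_eqI_AE by blast
next
  assume p: "p \<notin> {0, 1}"
  show "\<not> (\<exists>(N :: 'b measure) \<psi>. vertex_data N \<psi> \<and> erdos_renyi n p = vertex_edge_random_graph n N \<psi>)"
  proof clarify
    fix N :: "'b measure" and \<psi>
    assume data: "vertex_data N \<psi>" and eq: "erdos_renyi n p = vertex_edge_random_graph n N \<psi>"
    then have "AE z in N \<Otimes>\<^sub>M N. \<psi> z = p"
      using assms AE_eq_if_erdos_renyi_eq[of N \<psi> p n] by (simp add: vertex_data_def)
    with data have "p \<in> {0, 1}" by (rule vertex_data_imp_p_0_or_1)
    with p show False ..
  qed
qed

end
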